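(* For every forest $T$, the zero forcing graph $\mathscr{Z}(T)$ is connected.
   Context: All graphs are finite, simple and undirected (with nonempty vertex set). A forest is an acyclic graph (not necessarily connected). Zero forcing: vertices of a graph $G$ are colored blue or white; the color change rule says that a blue vertex $u$ can change the color of a white vertex $w$ to blue if $w$ is the unique white neighbor of $u$. A set $B\subseteq V(G)$ is a zero forcing set of $G$ if, starting with exactly the vertices of $B$ blue and applying the color change rule repeatedly, all vertices eventually become blue. The zero forcing number $\operatorname{Z}(G)$ is the minimum of $|B|$ over all zero forcing sets $B$ of $G$; a minimum zero forcing set is a zero forcing set $B$ with $|B|=\operatorname{Z}(G)$. The zero forcing graph $\mathscr{Z}(G)$ is the graph whose vertices are the minimum zero forcing sets of $G$, with $B$ and $B'$ adjacent if and only if $B'$ is obtained from $B$ by changing a single vertex, i.e. the symmetric difference of $B$ and $B'$ has exactly two elements. *)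

theory Defs
  imports "Graph_Theory.Graph_Theory"
begin

text \<open>
  A finite simple undirected graph is a symmetric digraph in the sense of the locale
  \<^locale>\<open>graph\<close>, each undirected edge being a pair of opposite arcs. The library's
  \<^const>\<open>forest\<close> is unsuitable here: it counts the back-and-forth walk along a single
  edge as a cycle, so it holds only for edgeless symmetric digraphs. In a simple graph that
  is the only spurious case, and the cycles of the undirected graph are exactly those of
  length at least 3.
\<close>

definition acyclic_graph :: "('a, 'b) pre_digraph \<Rightarrow> bool" where
  "acyclic_graph G \<longleftrightarrow> \<not> (\<exists>p. pre_digraph.cycle G p \<and> 3 \<le> length p)"

text \<open>The state of the colouring is the set of blue vertices.\<close>

definition color_change :: "('a, 'b) pre_digraph \<Rightarrow> 'a set \<Rightarrow> 'a set \<Rightarrow> bool" where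
  "color_change G S S' \<longleftrightarrow>
     (\<exists>u w. u \<in> S \<and> {x. u \<rightarrow>\<^bsub>G\<^esub> x \<and> x \<notin> S} = {w} \<and> S' = insert w S)"

definition zero_forcing_set :: "('a, 'b) pre_digraph \<Rightarrow> 'a set \<Rightarrow> bool" where
  "zero_forcing_set G B \<longleftrightarrow> B \<subseteq> verts G \<and> (color_change G)\<^sup>*\<^sup>* B (verts G)"

definition zero_forcing_number :: "('a, 'b) pre_digraph \<Rightarrow> nat" where
  "zero_forcing_number G = (LEAST k. \<exists>B. zero_forcing_set G B \<and> card B = k)"

definition min_zero_forcing_set :: "('a, 'b) pre_digraph \<Rightarrow> 'a set \<Rightarrow> bool" where
  "min_zero_forcing_set G B \<longleftrightarrow> zero_forcing_set G B \<and> card B = zero_forcing_number G"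

definition zero_forcing_graph :: "('a, 'b) pre_digraph \<Rightarrow> 'a set pair_pre_digraph" where
  "zero_forcing_graph G =
     \<lparr> pverts = {B. min_zero_forcing_set G B},
       parcs = {(B, B'). min_zero_forcing_set G B \<and> min_zero_forcing_set G B' \<and>
                         card ((B - B') \<union> (B' - B)) = 2} \<rparr>"

lemma pair_graph_zero_forcing_graph:
  assumes "graph G"
  shows "pair_graph (zero_forcing_graph G)"
proof -
  interpret graph G by fact
  let ?P = "pverts (zero_forcing_graph G)" and ?A = "parcs (zero_forcing_graph G)"
  have "?P \<subseteq> Pow (verts G)"
    by (auto simp: zero_forcing_graph_def min_zero_forcing_set_def zero_forcing_set_def)
  then have fin: "finite ?P"
    by (rule finite_subset) simp
  have sub: "?A \<subseteq> ?P \<times> ?P"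
    by (auto simp: zero_forcing_graph_def)
  have finA: "finite ?A"
    by (rule finite_subset[OF sub]) (simp add: fin)
  have sym: "symmetric (with_proj (zero_forcing_graph G))"
    by (auto simp: symmetric_def sym_def zero_forcing_graph_def Un_commute)
  show ?thesis
    using sub fin finA sym
    by unfold_locales (auto simp: zero_forcing_graph_def)
qed

end

theory Submission
  imports Defs
begin

text \<open>
  The only property of forests used is that a relation along the edges which never uses an edge
  in both directions is acyclic. It implies that the zero forcing sets are exactly the sets of
  sources of covers of the vertices by disjoint directed paths; the minimum ones
  come from covers with the largest number of edges. Reversing one path moves at most one source.
  If v is joined to x in the cover and y is a neighbour of v that is an end of another path, then
  after suitable reversals x precedes v and y is the last vertex of its path, and the edge xv can
  be replaced by yv without changing the sources at all. Such exchanges transform any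
  two maximum covers into each other: at a leaf v of the symmetric difference of their edge
  sets, with edge vx belonging to the first cover only, maximality of the second one yields an
  edge xy belonging to the second cover only, and xy is replaced there by xv.
\<close>

section \<open>Directed relations along the edges of a forest\<close>

locale acyclic_sym_graph = graph +
  assumes acyclic_graph: "acyclic_graph G"
begin

lemma finite_arcs_ends: "finite (arcs_ends G)"
  by (simp add: arcs_ends_def)

lemma arcs_ends_in_verts: "(u, v) \<in> arcs_ends G \<Longrightarrow> u \<in> verts G \<and> v \<in> verts G"
  using adj_in_verts by blast

text \<open>A closed walk along \<open>D\<close> would contain a cycle of the subgraph
  \<open>H\<close>, hence of \<open>G\<close>, and so of length 1 or 2. Asymmetry of
  \<open>D\<close> excludes both: a loop, and an edge used back and forth.\<close>

lemma acyclic_if_asym: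
  assumes "D \<subseteq> arcs_ends G" "asym D"
  shows "acyclic D"
proof (rule acyclicI, intro allI notI)
  fix x assume x: "(x, x) \<in> D\<^sup>+"
  define H where "H = G\<lparr>arcs := {a \<in> arcs G. (tail G a, head G a) \<in> D}\<rparr>"
  interpret H: wf_digraph H
    by unfold_locales (auto simp: H_def)
  have "arcs_ends H = D"
    using assms(1) by (auto simp: H_def arcs_ends_conv)
  with x obtain p where "H.awalk x p x" "p \<noteq> []"
    using H.reachable1_awalk[of x x] by auto
  then have "H.closed_w p"
    by (auto simp: H.closed_w_def)
  then obtain q where q: "H.cycle q"
    using H.closed_w_imp_cycle by blast
  have "subgraph H G"
    by (rule subgraphI) (auto simp: H_def compatible_def H.wf_digraph_axioms[unfolded H_def] wf_digraph_axioms)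
  then have "cycle q"
    using q subgraph_cycle by blast
  then have len: "length q < 3"
    using acyclic_graph by (auto simp: acyclic_graph_def not_le)
  obtain u where u: "H.awalk u q u" "q \<noteq> []"
    using q by (auto simp: H.cycle_def)
  then have arcs: "set q \<subseteq> arcs H" and cas: "H.cas u q u"
    by (auto simp: H.awalk_def)
  from len u(2) consider a where "q = [a]" | a b where "q = [a, b]"
    by (cases q rule: remdups_adj.cases) (auto simp: Suc_le_eq)
  then show False
    using arcs cas assms(2) by cases (auto simp: H_def pre_digraph.cas.simps dest: asymD)
qed

section \<open>Forcing relations and zero forcing sets\<close>

text \<open>A forcing relation records who forces whom: it splits the vertices into directed paths
  (forcing chains), and its sources, the first vertices of the chains, are the vertices that
  are blue from the start.\<close>

definition forcing :: "'a rel \<Rightarrow> bool" where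
  "forcing D \<longleftrightarrow> D \<subseteq> arcs_ends G \<and> single_valued D \<and> single_valued (D\<inverse>) \<and> asym D"

definition sources :: "'a rel \<Rightarrow> 'a set" where
  "sources D = verts G - Range D"

lemma forcingD:
  assumes "forcing D"
  shows "(x, y) \<in> D \<Longrightarrow> (x, y) \<in> arcs_ends G"
    and "(x, y) \<in> D \<Longrightarrow> (x, z) \<in> D \<Longrightarrow> y = z"
    and "(y, x) \<in> D \<Longrightarrow> (z, x) \<in> D \<Longrightarrow> y = z"
    and "(x, y) \<in> D \<Longrightarrow> (y, x) \<notin> D"
  using assms unfolding forcing_def by (auto dest: single_valuedD asymD)

lemma forcing_subset: "forcing D \<Longrightarrow> E \<subseteq> D \<Longrightarrow> forcing E"
  unfolding forcing_def by (meson asym_on_def converse_mono single_valued_subset subset_iff)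

lemma forcing_insert:
  assumes "forcing D" "(u, w) \<in> arcs_ends G" "u \<notin> Domain D" "w \<notin> Range D" "(w, u) \<notin> D"
  shows "forcing (insert (u, w) D)"
proof -
  note D = forcingD[OF assms(1)]
  have "insert (u, w) D \<subseteq> arcs_ends G"
    using D(1) assms(2) by auto
  moreover have "single_valued (insert (u, w) D)"
    by (rule single_valuedI) (use assms(3) D(2) in blast)
  moreover have "single_valued ((insert (u, w) D)\<inverse>)"
    by (rule single_valuedI) (use assms(4) D(3) in blast)
  moreover have "asym (insert (u, w) D)"
    by (rule asymI) (use assms(2,5) D(4) adj_not_same in blast)
  ultimately show ?thesis
    by (simp add: forcing_def)
qed

lemma forcing_acyclic: "forcing D \<Longrightarrow> acyclic D"
  unfolding forcing_def by (simp add: acyclic_if_asym)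

lemma finite_forcing: "forcing D \<Longrightarrow> finite D"
  unfolding forcing_def using finite_arcs_ends finite_subset by blast

lemma Range_forcing: "forcing D \<Longrightarrow> Range D \<subseteq> verts G"
  using forcingD(1) arcs_ends_in_verts by blast

text \<open>Distinct pairs of \<open>D\<close> end in distinct vertices, so \<open>D\<close> has as
  many pairs as there are non-sources. Fewest sources therefore means most edges.\<close>

lemma card_sources:
  assumes "forcing D"
  shows "card (sources D) + card D = card (verts G)"
proof -
  have "inj_on snd D"
    by (rule inj_onI) (auto dest: forcingD(3)[OF assms])
  then have "card (Range D) = card D"
    by (simp add: card_image Range_snd)
  moreover have "card (sources D) + card (Range D) = card (verts G)"
    using Range_forcing[OF assms] unfolding sources_def
    by (simp add: card_Diff_subset finite_subset[OF _ finite_verts] card_mono)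
  ultimately show ?thesis by simp
qed

text \<open>\<open>D\<close> collects the pairs of a forcing and a forced vertex. The invariant that
  all neighbours of a vertex in \<open>Domain D\<close> are already blue shows that no vertex forces
  twice.\<close>

lemma forcing_of_color_changes:
  assumes "(color_change G)\<^sup>*\<^sup>* B S" "B \<subseteq> verts G"
  shows "\<exists>D. forcing D \<and> Range D = S - B \<and> B \<subseteq> S \<and> S \<subseteq> verts G \<and> Domain D \<subseteq> S
    \<and> (\<forall>u\<in>Domain D. \<forall>x. (u, x) \<in> arcs_ends G \<longrightarrow> x \<in> S)"
  using assms(1)
proof (induction rule: rtranclp_induct)
  case base
  show ?case
    using assms(2) by (intro exI[of _ "{}"]) (auto simp: forcing_def)
next
  case (step S S')
  then obtain D where D: "forcing D" "Range D = S - B" "B \<subseteq> S" "S \<subseteq> verts G" "Domain D \<subseteq> S"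
    "\<And>u x. u \<in> Domain D \<Longrightarrow> (u, x) \<in> arcs_ends G \<Longrightarrow> x \<in> S" by blast
  obtain u w where uw: "u \<in> S" "{x. (u, x) \<in> arcs_ends G \<and> x \<notin> S} = {w}" "S' = insert w S"
    using step.hyps(2) unfolding color_change_def by blast
  have w: "(u, w) \<in> arcs_ends G" "w \<notin> S" "\<And>x. (u, x) \<in> arcs_ends G \<Longrightarrow> x \<notin> S \<Longrightarrow> x = w"
    using uw(2) by blast+
  have u: "u \<notin> Domain D" and wD: "w \<notin> Domain D" "w \<notin> Range D"
    using D w by blast+
  have "forcing (insert (u, w) D)"
    using D(1) u wD w(1) by (intro forcing_insert) auto
  moreover have "Range (insert (u, w) D) = S' - B" "B \<subseteq> S'" "S' \<subseteq> verts G" "Domain (insert (u, w) D) \<subseteq> S'"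
    using D(2-5) w(2) uw(1,3) arcs_ends_in_verts[OF w(1)] by auto
  moreover have "x \<in> S'" if "v \<in> Domain (insert (u, w) D)" "(v, x) \<in> arcs_ends G" for v x
    using that D(6)[of v x] w(3)[of x] uw(3) by auto
  ultimately show ?case by (intro exI[of _ "insert (u, w) D"]) simp
qed

lemma zero_forcing_set_obtain_forcing:
  assumes "zero_forcing_set G B"
  obtains D where "forcing D" "sources D = B"
proof -
  have B: "B \<subseteq> verts G" "(color_change G)\<^sup>*\<^sup>* B (verts G)"
    using assms by (auto simp: zero_forcing_set_def)
  obtain D where D: "forcing D" "Range D = verts G - B"
    using forcing_of_color_changes[OF B(2,1)] by blast
  have "sources D = B"
    using B(1) D(2) by (auto simp: sources_def)
  with D(1) show thesis by (rule that)
qed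

text \<open>Each colour change adds one vertex, so a reachable colouring of greatest cardinality
  admits none.\<close>

lemma color_changes_stuck:
  assumes "B \<subseteq> verts G"
  obtains S where "(color_change G)\<^sup>*\<^sup>* B S" "B \<subseteq> S" "S \<subseteq> verts G" "\<And>S'. \<not> color_change G S S'"
proof -
  let ?P = "\<lambda>S. (color_change G)\<^sup>*\<^sup>* B S"
  have sub: "B \<subseteq> S \<and> S \<subseteq> verts G" if "?P S" for S
    using forcing_of_color_changes[OF that assms] by blast
  then have bound: "card S \<le> card (verts G)" if "?P S" for S
    using that by (simp add: card_mono)
  obtain S where S: "?P S" "\<And>S'. ?P S' \<Longrightarrow> card S' \<le> card S"
    using ex_has_greatest_nat[of ?P B card "Suc (card (verts G))"] bound by (auto simp: less_Suc_eq_le)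
  have "\<not> color_change G S S'" for S'
  proof
    assume cc: "color_change G S S'"
    then have "?P S'" using S(1) by auto
    moreover have "card S' = Suc (card S)"
      using cc sub[OF S(1)] finite_subset[OF _ finite_verts]
      unfolding color_change_def by (auto intro!: card_insert_disjoint)
    ultimately show False using S(2) by fastforce
  qed
  with S(1) sub show thesis using that by blast
qed

text \<open>In a stuck colouring, walk from a white vertex back to its forcing predecessor, and
  from a blue vertex on to a white neighbour it is not supposed to force. This walk never
  backtracks and never ends, which is impossible in a forest.\<close>

lemma zero_forcing_set_sources:
  assumes "forcing D"
  shows "zero_forcing_set G (sources D)"
proof -
  note D = forcingD[OF assms]
  have "sources D \<subseteq> verts G" by (auto simp: sources_def)
  then obtain S where S: "(color_change G)\<^sup>*\<^sup>* (sources D) S" "sources D \<subseteq> S" "S \<subseteq> verts G"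
    and stuck: "\<And>S'. \<not> color_change G S S'"
    using color_changes_stuck by blast
  define N where "N = {(w, p). (p, w) \<in> D \<and> w \<notin> S} \<union>
    {(p, w). p \<in> S \<and> w \<notin> S \<and> (p, w) \<in> arcs_ends G - D}"
  have "N \<subseteq> arcs_ends G"
    unfolding N_def using D(1) graph_symmetric by blast
  moreover have "asym N"
    unfolding N_def by (rule asymI) (auto dest: D)
  ultimately have "wf (N\<inverse>)"
    using acyclic_if_asym finite_acyclic_wf_converse finite_arcs_ends finite_subset by metis
  \<comment> \<open>The vertices visited by the walk: white ones, and blue ones whose
    \<open>D\<close>-successor is still white. Each has an \<open>N\<close>-successor in
    \<open>Q\<close>, so well-foundedness of the converse of \<open>N\<close> leaves
    \<open>Q\<close> empty.\<close>
  define Q where "Q = (verts G - S) \<union> {p \<in> S. \<exists>w. w \<notin> S \<and> (p, w) \<in> D}"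
  have succ: "\<exists>y\<in>Q. (x, y) \<in> N" if x: "x \<in> Q" for x
  proof (cases "x \<in> S")
    case False
    then have "x \<in> Range D"
      using x S(2) unfolding Q_def sources_def by blast
    then obtain p where p: "(p, x) \<in> D" by blast
    then have "p \<in> Q"
      unfolding Q_def using False D(1) arcs_ends_in_verts by blast
    with p False show ?thesis unfolding N_def by blast
  next
    case True
    then obtain w where w: "w \<notin> S" "(x, w) \<in> D" using x unfolding Q_def by blast
    have "{y. (x, y) \<in> arcs_ends G \<and> y \<notin> S} \<noteq> {w}"
      using stuck True unfolding color_change_def by blast
    then obtain y where y: "(x, y) \<in> arcs_ends G" "y \<notin> S" "y \<noteq> w"
      using w D(1) by blast
    then have "(x, y) \<notin> D" using w D(2) by blast
    moreover have "y \<in> Q" unfolding Q_def using y arcs_ends_in_verts by blast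
    ultimately show ?thesis using y True unfolding N_def by blast
  qed
  have "Q = {}"
  proof (rule ccontr)
    assume "Q \<noteq> {}"
    then obtain z where "z \<in> Q" "\<And>y. (y, z) \<in> N\<inverse> \<Longrightarrow> y \<notin> Q"
      using wfE_min'[OF \<open>wf (N\<inverse>)\<close>] by blast
    then show False using succ by blast
  qed
  then have "S = verts G" using S(3) unfolding Q_def by blast
  with S \<open>sources D \<subseteq> verts G\<close> show ?thesis unfolding zero_forcing_set_def by blast
qed

section \<open>Maximum forcing relations and minimum zero forcing sets\<close>

definition max_forcing :: "'a rel \<Rightarrow> bool" where
  "max_forcing D \<longleftrightarrow> forcing D \<and> (\<forall>E. forcing E \<longrightarrow> card E \<le> card D)"

lemma max_forcingD: "max_forcing D \<Longrightarrow> forcing D"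
  by (simp add: max_forcing_def)

text \<open>Every zero forcing set is the source set of a forcing relation, and by
  \<open>card_sources\<close> none of these has fewer sources than a relation with the most
  edges.\<close>

lemma min_zero_forcing_set_sources:
  assumes "max_forcing D"
  shows "min_zero_forcing_set G (sources D)"
proof -
  have D: "forcing D" using assms by (rule max_forcingD)
  have "card (sources D) \<le> card B" if B: "zero_forcing_set G B" for B
  proof -
    obtain E where E: "forcing E" "sources E = B"
      using zero_forcing_set_obtain_forcing[OF B] by blast
    then have "card E \<le> card D" using assms by (simp add: max_forcing_def)
    then show ?thesis using card_sources[OF D] card_sources[OF E(1)] E(2) by simp
  qed
  then have "zero_forcing_number G = card (sources D)"
    unfolding zero_forcing_number_def
    using zero_forcing_set_sources[OF D] by (intro Least_equality) auto
  then show ?thesis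
    using zero_forcing_set_sources[OF D] by (simp add: min_zero_forcing_set_def)
qed

lemma min_zero_forcing_set_obtain_forcing:
  assumes "min_zero_forcing_set G B"
  obtains D where "max_forcing D" "sources D = B"
proof -
  obtain D where D: "forcing D" "sources D = B"
    using assms zero_forcing_set_obtain_forcing unfolding min_zero_forcing_set_def by blast
  have "card E \<le> card D" if "forcing E" for E
  proof -
    have "zero_forcing_number G \<le> card (sources E)"
      unfolding zero_forcing_number_def by (rule Least_le) (use zero_forcing_set_sources[OF that] in blast)
    then have "card (sources D) \<le> card (sources E)"
      using assms D(2) by (simp add: min_zero_forcing_set_def)
    then show ?thesis using card_sources[OF D(1)] card_sources[OF that] by simp
  qed
  then have "max_forcing D" using D(1) by (simp add: max_forcing_def)
  then show thesis using that D(2) by blast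
qed

lemma ex_max_forcing: "\<exists>D. max_forcing D"
proof -
  have "forcing {}" by (simp add: forcing_def asym_on_def)
  moreover have "card D < Suc (card (verts G))" if "forcing D" for D
    using card_sources[OF that] by simp
  ultimately show ?thesis
    using ex_has_greatest_nat[of forcing "{}" card "Suc (card (verts G))"]
    unfolding max_forcing_def by blast
qed

section \<open>Underlying edge sets and reachability in the zero forcing graph\<close>

definition edges :: "'a rel \<Rightarrow> 'a rel" where
  "edges D = D \<union> D\<inverse>"

lemma edges_iff: "(x, y) \<in> edges D \<longleftrightarrow> (x, y) \<in> D \<or> (y, x) \<in> D"
  by (auto simp: edges_def)

lemma edges_subset: "forcing D \<Longrightarrow> edges D \<subseteq> arcs_ends G"
  using forcingD(1) graph_symmetric by (auto simp: edges_def)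

lemma finite_edges: "forcing D \<Longrightarrow> finite (edges D)"
  by (simp add: edges_def finite_forcing)

lemma card_edges:
  assumes "forcing D"
  shows "card (edges D) = 2 * card D"
proof -
  have "D \<inter> D\<inverse> = {}"
    using forcingD(4)[OF assms] by auto
  then show ?thesis
    using finite_forcing[OF assms] by (simp add: edges_def card_Un_disjoint card_inverse)
qed

text \<open>Relates forcing relations rather than zero forcing sets, since the moves below act on
  relations and some leave the sources unchanged.\<close>

definition reconf :: "'a rel \<Rightarrow> 'a rel \<Rightarrow> bool" where
  "reconf D E \<longleftrightarrow> (sources D, sources E) \<in> (parcs (zero_forcing_graph G))\<^sup>*"

lemma reconf_trans [trans]: "reconf D E \<Longrightarrow> reconf E F \<Longrightarrow> reconf D F"
  unfolding reconf_def by (rule rtrancl_trans)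

lemma reconf_sym: "reconf D E \<Longrightarrow> reconf E D"
proof -
  have "sym (parcs (zero_forcing_graph G))"
    by (auto simp: sym_def zero_forcing_graph_def Un_commute)
  then show "reconf D E \<Longrightarrow> reconf E D"
    unfolding reconf_def by (meson sym_rtrancl symD)
qed

lemma reconf_if_sources_eq: "sources D = sources E \<Longrightarrow> reconf D E"
  by (simp add: reconf_def)

lemma max_forcing_if_card_eq:
  "max_forcing D \<Longrightarrow> forcing E \<Longrightarrow> card E = card D \<Longrightarrow> max_forcing E"
  by (simp add: max_forcing_def)

lemma max_forcing_card_eq: "max_forcing D \<Longrightarrow> max_forcing E \<Longrightarrow> card D = card E"
  by (simp add: max_forcing_def order_antisym)

section \<open>Reversal of one chain\<close>

text \<open>This reverses a whole chain only if b is a source; otherwise the result need not be a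
  forcing relation.\<close>

definition reverse :: "'a \<Rightarrow> 'a rel \<Rightarrow> 'a rel" where
  "reverse b D = {(x, y). if (b, x) \<in> D\<^sup>* then (y, x) \<in> D else (x, y) \<in> D}"

lemma in_reverse_iff: "(x, y) \<in> reverse b D \<longleftrightarrow> (if (b, x) \<in> D\<^sup>* then (y, x) \<in> D else (x, y) \<in> D)"
  by (simp add: reverse_def)

text \<open>A vertex has at most one predecessor and \<open>b\<close> has none, so \<open>y\<close>
  can be reached from \<open>b\<close> only through \<open>x\<close>. Hence
  \<open>reverse b D\<close> turns the whole chain of \<open>b\<close> and touches no other.\<close>

lemma chain_closed:
  assumes "forcing D" "b \<in> sources D" "(x, y) \<in> D"
  shows "(b, x) \<in> D\<^sup>* \<longleftrightarrow> (b, y) \<in> D\<^sup>*"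
proof
  assume "(b, y) \<in> D\<^sup>*"
  then show "(b, x) \<in> D\<^sup>*"
  proof (cases rule: rtranclE)
    case base
    then show ?thesis using assms(2,3) by (auto simp: sources_def)
  next
    case (step z)
    then show ?thesis using forcingD(3)[OF assms(1,3)] by blast
  qed
qed (use assms(3) in auto)

lemma edges_reverse:
  assumes "forcing D" "b \<in> sources D"
  shows "edges (reverse b D) = edges D"
  using chain_closed[OF assms] by (auto simp: edges_iff in_reverse_iff split: if_splits)

lemma forcing_reverse:
  assumes "forcing D" "b \<in> sources D"
  shows "forcing (reverse b D)"
proof -
  note D = forcingD[OF assms(1)] and closed = chain_closed[OF assms]
  have "reverse b D \<subseteq> arcs_ends G"
    using edges_reverse[OF assms] edges_subset[OF assms(1)] by (auto simp: edges_def)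
  moreover have "single_valued (reverse b D)"
    by (rule single_valuedI) (auto simp: in_reverse_iff dest: D split: if_splits)
  moreover have "single_valued ((reverse b D)\<inverse>)"
    by (rule single_valuedI) (auto simp: in_reverse_iff closed dest: D split: if_splits)
  moreover have "asym (reverse b D)"
    by (rule asymI) (auto simp: in_reverse_iff closed dest: D split: if_splits)
  ultimately show ?thesis
    by (simp add: forcing_def)
qed

lemma max_forcing_reverse:
  assumes "max_forcing D" "b \<in> sources D"
  shows "max_forcing (reverse b D)"
proof -
  have D: "forcing D" using assms(1) by (rule max_forcingD)
  then have "card (reverse b D) = card D"
    using card_edges forcing_reverse edges_reverse assms(2) by (metis mult_cancel1 zero_neq_numeral)
  then show ?thesis
    using max_forcing_if_card_eq assms forcing_reverse D by blast
qed

text \<open>Off the chain \<open>?C\<close> of \<open>b\<close> no source changes, and the number of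
  sources is preserved. As \<open>b\<close> was the only source on \<open>?C\<close>, exactly one
  vertex \<open>e\<close> is a source there afterwards; this counting replaces a search for the last
  vertex of the chain.\<close>

lemma reconf_reverse:
  assumes "max_forcing D" "b \<in> sources D"
  shows "reconf D (reverse b D)"
proof -
  let ?C = "D\<^sup>* `` {b}" and ?S = "sources D" and ?S' = "sources (reverse b D)"
  have D: "forcing D" using assms(1) by (rule max_forcingD)
  note closed = chain_closed[OF D assms(2)]
  have fin: "finite ?S" "finite ?S'"
    by (simp_all add: sources_def)
  have "(y, x) \<in> reverse b D \<longleftrightarrow> (y, x) \<in> D" if "(b, x) \<notin> D\<^sup>*" for x y
    using that closed[of x y] closed[of y x] by (auto simp: in_reverse_iff)
  then have out: "?S - ?C = ?S' - ?C"
    by (auto simp: sources_def Range_iff)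
  have "x = b" if "x \<in> ?S" "(b, x) \<in> D\<^sup>*" for x
    using that(2,1) by (cases rule: rtranclE) (auto simp: sources_def)
  then have S: "?S \<inter> ?C = {b}"
    using assms(2) by auto
  have card: "card ?S' = card ?S"
    using card_sources[OF D] card_sources[OF forcing_reverse[OF D assms(2)]]
      max_forcing_card_eq[OF assms(1) max_forcing_reverse[OF assms]] by simp
  have "card (?S \<inter> ?C) + card (?S - ?C) = card ?S" "card (?S' \<inter> ?C) + card (?S' - ?C) = card ?S'"
    using card_Int_Diff[OF fin(1), of ?C] card_Int_Diff[OF fin(2), of ?C] by simp_all
  then have "card (?S' \<inter> ?C) = 1"
    using card S out by simp
  then obtain e where e: "?S' \<inter> ?C = {e}"
    using card_1_singletonE by blast
  show ?thesis
  proof (cases "e = b")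
    \<comment> \<open>The chain then consists of \<open>b\<close> alone.\<close>
    case True
    then have "?S \<inter> ?C \<union> (?S - ?C) = ?S' \<inter> ?C \<union> (?S' - ?C)" using out S e by simp
    then have "?S = ?S'" by (simp only: Int_Diff_Un)
    then show ?thesis by (rule reconf_if_sources_eq)
  next
    case False
    have "?S = insert b (?S - ?C)" "?S' = insert e (?S - ?C)"
      using out S e by blast+
    moreover have "b \<in> ?C" "e \<in> ?C"
      using S e by blast+
    ultimately have "(?S - ?S') \<union> (?S' - ?S) = {b, e}"
      using False by auto
    then have "(?S, ?S') \<in> parcs (zero_forcing_graph G)"
      using False min_zero_forcing_set_sources assms max_forcing_reverse
      by (simp add: zero_forcing_graph_def)
    then show ?thesis by (auto simp: reconf_def)
  qed
qed

section \<open>Exchanging one edge of a cover\<close>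

lemma ex_source:
  assumes "forcing D" "v \<in> verts G"
  shows "\<exists>b\<in>sources D. (b, v) \<in> D\<^sup>*"
proof -
  have "wf D"
    using assms(1) finite_acyclic_wf finite_forcing forcing_acyclic by blast
  then show ?thesis using assms(2)
  proof (induction v)
    case (less v)
    show ?case
    proof (cases "v \<in> Range D")
      case True
      then obtain u where u: "(u, v) \<in> D" by blast
      then have "u \<in> verts G" using assms(1) forcingD(1) arcs_ends_in_verts by blast
      with less.IH u show ?thesis by (meson rtrancl.rtrancl_into_rtrancl)
    qed (use less.prems in \<open>auto simp: sources_def\<close>)
  qed
qed

text \<open>\<open>E\<close> arises by reversing the chain of \<open>y\<close> if \<open>y\<close>
  has a successor, and \<open>F\<close> from \<open>E\<close> by reversing the chain through
  \<open>v\<close>. That chain does not contain \<open>y\<close>, so \<open>y\<close> stays without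
  successor, and the direction at \<open>v\<close> can be chosen freely.\<close>

lemma reorient:
  assumes "max_forcing D" "(v, y) \<in> arcs_ends G" "(v, y) \<notin> edges D" "y \<notin> Domain D \<or> y \<notin> Range D"
  obtains E F where "max_forcing E" "reconf D E" "edges E = edges D" "y \<notin> Domain E"
    and "max_forcing F" "reconf D F" "edges F = edges D" "y \<notin> Domain F"
    and "\<And>a. (a, v) \<in> F \<longleftrightarrow> (v, a) \<in> E"
proof -
  have vy: "v \<in> verts G" "y \<in> verts G" "v \<noteq> y"
    using assms(2) arcs_ends_in_verts adj_not_same by auto
  have D: "forcing D" using assms(1) by (rule max_forcingD)
  obtain E where E: "max_forcing E" "reconf D E" "edges E = edges D" "y \<notin> Domain E"
  proof (cases "y \<in> Domain D")
    case True
    then have y: "y \<in> sources D" using assms(4) vy by (auto simp: sources_def)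
    have "y \<notin> Domain (reverse y D)"
      using y by (auto simp: in_reverse_iff sources_def)
    with that[of "reverse y D"] y assms(1) show ?thesis
      using D edges_reverse max_forcing_reverse reconf_reverse by blast
  next
    case False
    then show ?thesis using that[of D] assms(1) reconf_if_sources_eq by blast
  qed
  have fE: "forcing E" using E(1) by (rule max_forcingD)
  obtain b where b: "b \<in> sources E" "(b, v) \<in> E\<^sup>*"
    using ex_source[OF fE vy(1)] by blast
  \<comment> \<open>Otherwise the chain between v and y would close up to a cycle through the new edge.\<close>
  have y_out: "(b, y) \<notin> E\<^sup>*"
  proof
    assume "(b, y) \<in> E\<^sup>*"
    then have "(v, y) \<in> E\<^sup>* \<or> (y, v) \<in> E\<^sup>*"
      using single_valued_confluent b(2) fE unfolding forcing_def by metis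
    moreover have "(y, v) \<notin> E\<^sup>*"
      using E(4) vy(3) by (auto elim: converse_rtranclE)
    ultimately have "(v, y) \<in> (insert (y, v) E)\<^sup>*"
      using rtrancl_mono[of E "insert (y, v) E"] by blast
    then have "(y, y) \<in> (insert (y, v) E)\<^sup>+"
      by (meson insertI1 rtrancl_into_trancl2)
    moreover have "acyclic (insert (y, v) E)"
    proof (rule acyclic_if_asym)
      show "insert (y, v) E \<subseteq> arcs_ends G"
        using forcingD(1)[OF fE] graph_symmetric[OF assms(2)] by auto
      show "asym (insert (y, v) E)"
      proof (rule asymI)
        have "(v, y) \<notin> E"
          using assms(3) unfolding E(3)[symmetric] edges_iff by blast
        then show "(c, a) \<notin> insert (y, v) E" if "(a, c) \<in> insert (y, v) E" for a c
          using that forcingD(4)[OF fE, of a c] vy(3) by auto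
      qed
    qed
    ultimately show False by (auto simp: acyclic_def)
  qed
  show thesis
  proof (rule that[OF E, of "reverse b E"])
    show "max_forcing (reverse b E)" "edges (reverse b E) = edges D"
      using E b(1) fE max_forcing_reverse edges_reverse by auto
    show "reconf D (reverse b E)"
      using E b(1) reconf_reverse reconf_trans by blast
    show "y \<notin> Domain (reverse b E)"
      using y_out E(4) by (auto simp: in_reverse_iff)
    show "(a, v) \<in> reverse b E \<longleftrightarrow> (v, a) \<in> E" for a
    proof -
      have "(a, v) \<notin> E" if "(b, a) \<notin> E\<^sup>*"
        using that chain_closed[OF fE b(1)] b(2) by blast
      moreover have "(v, a) \<notin> E" if "(b, a) \<notin> E\<^sup>*"
        using that chain_closed[OF fE b(1)] b(2) by blast
      ultimately show ?thesis by (auto simp: in_reverse_iff)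
    qed
  qed
qed

text \<open>With \<open>x\<close> before \<open>v\<close> and \<open>y\<close> last on its chain,
  replacing \<open>(x, v)\<close> by \<open>(y, v)\<close> changes neither \<open>Range\<close> nor
  the number of pairs. Sources move only during the reorientation.\<close>

lemma exchange:
  assumes "max_forcing D" "(v, x) \<in> edges D" "(v, y) \<in> arcs_ends G" "(v, y) \<notin> edges D"
    and "y \<notin> Domain D \<or> y \<notin> Range D"
  shows "\<exists>E. max_forcing E \<and> reconf D E \<and>
    edges E = edges D - {(v, x), (x, v)} \<union> {(v, y), (y, v)}"
proof -
  \<comment> \<open>\<open>reorient\<close> yields two relations with opposite directions at
    \<open>v\<close>; the one containing \<open>(x, v)\<close> is taken.\<close>
  obtain E where E: "max_forcing E" "reconf D E" "edges E = edges D" "y \<notin> Domain E" "(x, v) \<in> E"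
    using reorient[OF assms(1,3-5)] assms(2) by (metis edges_iff)
  have fE: "forcing E" using E(1) by (rule max_forcingD)
  let ?F = "insert (y, v) (E - {(x, v)})"
  have vy: "(v, y) \<notin> E" "(y, v) \<notin> E"
    using assms(4) unfolding E(3)[symmetric] edges_iff by auto
  have F: "forcing ?F"
  proof (rule forcing_insert)
    show "forcing (E - {(x, v)})" using fE by (rule forcing_subset) blast
    show "(y, v) \<in> arcs_ends G" using assms(3) by (rule graph_symmetric)
    show "v \<notin> Range (E - {(x, v)})" using forcingD(3)[OF fE E(5)] by blast
  qed (use E(4) vy in blast)+
  have "finite E" using fE by (rule finite_forcing)
  then have "card ?F = card E"
    using vy(2) card_Suc_Diff1[OF _ E(5)] by simp
  then have "max_forcing ?F"
    using max_forcing_if_card_eq E(1) F by blast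
  moreover have "Range ?F = Range E"
    using E(5) by auto
  then have "sources E = sources ?F" by (simp add: sources_def)
  then have "reconf D ?F" using E(2) reconf_if_sources_eq reconf_trans by blast
  moreover have "edges ?F = edges E - {(v, x), (x, v)} \<union> {(v, y), (y, v)}"
    using forcingD(4)[OF fE E(5)] unfolding edges_def by blast
  ultimately show ?thesis using E(3) by metis
qed

text \<open>Otherwise the edge between v and y could be added.\<close>

lemma max_forcing_blocked:
  assumes "max_forcing D" "(v, y) \<in> arcs_ends G" "(v, y) \<notin> edges D"
    and "y \<notin> Domain D \<or> y \<notin> Range D"
  shows "v \<in> Domain D \<and> v \<in> Range D"
proof (rule ccontr)
  assume v: "\<not> (v \<in> Domain D \<and> v \<in> Range D)"
  have deg: "a = c" if "(v, a) \<in> edges D" "(v, c) \<in> edges D" for a c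
    using that v forcingD(2,3)[OF max_forcingD[OF assms(1)]] by (auto simp: edges_iff)
  obtain E where E: "max_forcing E" "edges E = edges D" "y \<notin> Domain E" "v \<notin> Range E"
  proof (rule reorient[OF assms])
    fix E F
    assume E: "max_forcing E" "edges E = edges D" "y \<notin> Domain E"
      and F: "max_forcing F" "edges F = edges D" "y \<notin> Domain F"
      and flip: "\<And>a. (a, v) \<in> F \<longleftrightarrow> (v, a) \<in> E"
    show thesis
    proof (cases "v \<in> Range E")
      \<comment> \<open>The only edge at \<open>v\<close> enters it from \<open>a\<close> in
        \<open>E\<close>, hence leaves it in \<open>F\<close>, so \<open>v\<close> has no
        predecessor in \<open>F\<close>.\<close>
      case True
      then obtain a where a: "(a, v) \<in> E" by blast
      have "v \<notin> Range F"
      proof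
        assume "v \<in> Range F"
        then obtain c where c: "(v, c) \<in> E" using flip by blast
        then have "a = c" using a deg E(2) by (metis edges_iff)
        then show False using a c forcingD(4)[OF max_forcingD[OF E(1)]] by blast
      qed
      then show thesis using that F by blast
    qed (use that E in blast)
  qed
  have fE: "forcing E" using E(1) by (rule max_forcingD)
  have "(y, v) \<notin> E" "(v, y) \<notin> E" using assms(3) unfolding E(2)[symmetric] edges_iff by auto
  moreover from this have "forcing (insert (y, v) E)"
    using forcing_insert[OF fE] E(3,4) graph_symmetric[OF assms(2)] by blast
  ultimately show False
    using E(1) finite_forcing[OF fE] unfolding max_forcing_def by fastforce
qed

section \<open>Covers with the same edges\<close>

text \<open>Induction on the number of pairs directed differently. Among the first vertices of such
  pairs let \<open>b\<close> be minimal for \<open>D\<close>. Then \<open>b\<close> starts a chain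
  of \<open>D\<close> that is directed oppositely throughout in \<open>E\<close>, and reversing it
  reduces the disagreement.\<close>

lemma reconf_if_edges_eq:
  assumes "max_forcing D" "max_forcing E" "edges D = edges E"
  shows "reconf D E"
  using assms
proof (induction "card (D - E)" arbitrary: D rule: less_induct)
  case less
  have fD: "forcing D" and fE: "forcing E" using less.prems by (simp_all add: max_forcingD)
  note D = forcingD[OF fD] and E = forcingD[OF fE]
  have edge: "(x, y) \<in> E \<or> (y, x) \<in> E" if "(x, y) \<in> D" for x y
    using that less.prems(3) edges_iff by metis
  have edge': "(x, y) \<in> D \<or> (y, x) \<in> D" if "(x, y) \<in> E" for x y
    using that less.prems(3) edges_iff by metis
  show ?case
  proof (cases "D - E = {}")
    case True
    then have sub: "D \<subseteq> E" by simp
    have "E \<subseteq> D"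
    proof (rule subrelI)
      fix x y assume xy: "(x, y) \<in> E"
      then have "(y, x) \<notin> D" using sub E(4) by blast
      with xy show "(x, y) \<in> D" using edge' by blast
    qed
    with sub have "D = E" by simp
    then show ?thesis by (simp add: reconf_if_sources_eq)
  next
    case False
    have "wf D" using fD finite_acyclic_wf finite_forcing forcing_acyclic by blast
    moreover have "fst ` (D - E) \<noteq> {}" using False by simp
    ultimately obtain b where b: "b \<in> fst ` (D - E)" and bmin: "\<And>a. (a, b) \<in> D \<Longrightarrow> a \<notin> fst ` (D - E)"
      using wfE_min' by metis
    then obtain c where c: "(b, c) \<in> D" "(b, c) \<notin> E" by auto
    have cb: "(c, b) \<in> E" using c edge by blast
    \<comment> \<open>A predecessor \<open>a\<close> of \<open>b\<close> in \<open>D\<close> would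
      by minimality also precede \<open>b\<close> in \<open>E\<close>, where \<open>c\<close>
      already does.\<close>
    have "b \<notin> Range D"
    proof
      assume "b \<in> Range D"
      then obtain a where a: "(a, b) \<in> D" by blast
      then have "(a, b) \<in> E" using bmin by force
      then have "a = c" using cb E(3) by blast
      then show False using a c(1) D(4) by blast
    qed
    then have src: "b \<in> sources D"
      using arcs_ends_in_verts[OF D(1)[OF c(1)]] by (simp add: sources_def)
    \<comment> \<open>Disagreement propagates along the chain: in \<open>E\<close> the successor of
      \<open>z\<close> is already the vertex \<open>x\<close> behind it, so the next edge cannot
      point forward.\<close>
    have rev: "(y, x) \<in> E" if "(b, x) \<in> D\<^sup>*" "(x, y) \<in> D" for x y
      using that
    proof (induction arbitrary: y rule: rtrancl_induct)
      case base
      then show ?case using c(1) cb D(2) by blast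
    next
      case (step x z)
      have "(z, x) \<in> E" using step.IH step.hyps(2) by blast
      then have "(z, y) \<notin> E" using E(2) D(4) step.hyps(2) step.prems by blast
      then show ?case using edge step.prems by blast
    qed
    let ?F = "reverse b D"
    have F: "max_forcing ?F" "edges ?F = edges E" "reconf D ?F"
      using less.prems src fD max_forcing_reverse edges_reverse reconf_reverse by auto
    have "?F - E \<subseteq> D - E"
    proof
      fix p assume p: "p \<in> ?F - E"
      obtain x y where xy: "p = (x, y)" by force
      show "p \<in> D - E"
      proof (cases "(b, x) \<in> D\<^sup>*")
        case True
        then have yx: "(y, x) \<in> D" using p xy by (simp add: in_reverse_iff)
        then have "(b, y) \<in> D\<^sup>*" using True chain_closed[OF fD src] by blast
        then have "(x, y) \<in> E" using yx rev by blast
        then show ?thesis using p xy by blast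
      next
        case False
        then show ?thesis using p xy by (simp add: in_reverse_iff)
      qed
    qed
    moreover have "(b, c) \<notin> ?F"
      using D(4)[OF c(1)] by (simp add: in_reverse_iff)
    ultimately have "?F - E \<subset> D - E" using c by blast
    then have "card (?F - E) < card (D - E)"
      using finite_forcing[OF fD] by (simp add: psubset_card_mono)
    then have "reconf ?F E" using less.hyps F less.prems(2) by blast
    with F(3) show ?thesis by (rule reconf_trans)
  qed
qed

section \<open>Paths and leaves in a forest\<close>

text \<open>\<open>R\<close> directs the path from \<open>a\<close> onwards, and the chord, directed
  from \<open>c\<close> back to \<open>a\<close>, closes a cycle. The resulting relation is still
  asymmetric because \<open>c\<close> is not next to \<open>a\<close> on the path, which contradicts
  \<open>acyclic_if_asym\<close>.\<close>

lemma path_no_chord: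
  assumes "distinct (a # b # ys)" "successively (\<lambda>u v. (u, v) \<in> arcs_ends G) (a # b # ys)"
    and "c \<in> set ys" "(a, c) \<in> arcs_ends G"
  shows False
proof -
  define R where "R zs = set (zip zs (tl zs))" for zs :: "'a list"
  have R_Cons: "R (u # v # zs) = insert (u, v) (R (v # zs))" for u v zs
    by (simp add: R_def)
  have R_set: "R zs \<subseteq> set zs \<times> set zs" for zs
    unfolding R_def by (cases zs) (auto dest: set_zip_leftD set_zip_rightD)
  have R_path: "R zs \<subseteq> arcs_ends G" if "successively (\<lambda>u v. (u, v) \<in> arcs_ends G) zs" for zs
    using that by (induction zs rule: induct_list012) (auto simp: R_def)
  have R_reach: "(u, v) \<in> (R (u # zs))\<^sup>*" if "v \<in> set (u # zs)" for u v zs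
    using that
  proof (induction zs arbitrary: u)
    case (Cons w zs)
    show ?case
    proof (cases "v = u")
      case False
      then have "(w, v) \<in> (R (w # zs))\<^sup>*" using Cons by auto
      then have "(w, v) \<in> (R (u # w # zs))\<^sup>*"
        unfolding R_Cons using rtrancl_mono[of "R (w # zs)"] by blast
      then show ?thesis
        unfolding R_Cons by (meson converse_rtrancl_into_rtrancl insertI1)
    qed simp
  qed simp
  have R_asym: "asym (R zs)" if "distinct zs" for zs
    using that
  proof (induction zs rule: induct_list012)
    case (3 u v zs)
    then have "asym (R (v # zs))" "u \<notin> set (v # zs)" by simp_all
    then show ?case
      unfolding R_Cons asym_iff using R_set[of "v # zs"] by auto
  qed (simp_all add: R_def asym_on_def)
  let ?R = "insert (c, a) (R (a # b # ys))"
  have "?R \<subseteq> arcs_ends G"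
    using R_path[OF assms(2)] graph_symmetric[OF assms(4)] by simp
  moreover have "asym ?R"
  proof -
    have "(a, c) \<notin> R (a # b # ys)"
      using assms(1,3) R_set[of "b # ys"] unfolding R_Cons by auto
    moreover have "a \<noteq> c" using assms(1,3) by auto
    ultimately show ?thesis
      using R_asym[OF assms(1)] unfolding asym_iff by blast
  qed
  ultimately have "acyclic ?R" by (rule acyclic_if_asym)
  moreover have "(a, c) \<in> (R (a # b # ys))\<^sup>*"
    using R_reach assms(3) by simp
  then have "(a, c) \<in> ?R\<^sup>*"
    using rtrancl_mono[of "R (a # b # ys)" ?R] by blast
  then have "(a, a) \<in> ?R\<^sup>+"
    by (meson insertI1 rtrancl_into_trancl1)
  ultimately show False by (simp add: acyclic_def)
qed

text \<open>The leaf is the first vertex of a longest path in \<open>H\<close>: a neighbour off the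
  path would extend it, and one beyond the second vertex would give a chord.\<close>

lemma ex_leaf:
  assumes "H \<subseteq> arcs_ends G" "sym H" "H \<noteq> {}"
  obtains v x where "(v, x) \<in> H" "\<And>y. (v, y) \<in> H \<Longrightarrow> y = x"
proof -
  define P where "P zs \<longleftrightarrow> distinct zs \<and> successively (\<lambda>u v. (u, v) \<in> H) zs \<and> set zs \<subseteq> verts G" for zs
  obtain u w where uw: "(u, w) \<in> H" using assms(3) by auto
  have P0: "P [u, w]"
    using uw assms(1) arcs_ends_in_verts adj_not_same by (auto simp: P_def)
  have "length zs < Suc (card (verts G))" if "P zs" for zs
    using that by (metis P_def card_mono distinct_card finite_verts less_Suc_eq_le)
  then obtain zs where zs: "P zs" and longest: "\<And>zs'. P zs' \<Longrightarrow> length zs' \<le> length zs"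
    using ex_has_greatest_nat[of P "[u, w]" length "Suc (card (verts G))"] P0 by blast
  \<comment> \<open>The path \<open>[u, w]\<close> shows that a longest one has at least two
    vertices.\<close>
  then obtain a b ys where ys: "zs = a # b # ys"
    using longest[OF P0] by (cases zs rule: remdups_adj.cases) auto
  show thesis
  proof (rule that[of a b])
    show "(a, b) \<in> H" using zs ys by (simp add: P_def)
    fix c assume c: "(a, c) \<in> H"
    then have ac: "(a, c) \<in> arcs_ends G" and ca: "(c, a) \<in> H"
      using assms(1,2) by (auto dest: symD)
    then have cV: "c \<in> verts G" "c \<noteq> a"
      using arcs_ends_in_verts adj_not_same by blast+
    have "c \<in> set zs"
    proof (rule ccontr)
      assume "c \<notin> set zs"
      then have "P (c # zs)" using zs ys ca cV by (simp add: P_def)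
      then show False using longest[of "c # zs"] by simp
    qed
    moreover have "successively (\<lambda>u v. (u, v) \<in> arcs_ends G) zs"
      using zs assms(1) unfolding P_def by (auto elim: successively_mono)
    ultimately show "c = b"
      using path_no_chord[of a b ys c] zs ys ac cV(2) unfolding P_def by auto
  qed
qed

section \<open>Transforming one maximum cover into another\<close>

lemma no_three_edges:
  assumes "forcing D" "(v, a) \<in> edges D" "(v, b) \<in> edges D" "(v, c) \<in> edges D"
    and "a \<noteq> b" "a \<noteq> c" "b \<noteq> c"
  shows False
  using assms(2-) forcingD(2,3)[OF assms(1)] unfolding edges_iff by metis

text \<open>By \<open>no_three_edges\<close> for \<open>D\<close> at \<open>v\<close>, the vertex
  \<open>v\<close> is an end of its path in \<open>E\<close>, so \<open>max_forcing_blocked\<close>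
  gives \<open>x\<close> two edges in \<open>E\<close>. By \<open>no_three_edges\<close> for
  \<open>D\<close> at \<open>x\<close>, one of them is missing in \<open>D\<close>.\<close>

lemma exchange_towards:
  assumes "max_forcing D" "max_forcing E" "(v, x) \<in> edges D" "(v, x) \<notin> edges E"
    and leaf: "\<And>z. (v, z) \<in> edges E \<Longrightarrow> (v, z) \<in> edges D"
  obtains F y where "max_forcing F" "reconf E F" "(x, y) \<in> edges E - edges D"
    and "edges F = edges E - {(x, y), (y, x)} \<union> {(x, v), (v, x)}"
proof -
  have fD: "forcing D" and fE: "forcing E" using assms by (simp_all add: max_forcingD)
  have xv: "(x, v) \<in> arcs_ends G" "(x, v) \<notin> edges E" "(x, v) \<in> edges D"
    using assms(3,4) edges_subset[OF fD] by (auto simp: edges_iff)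
  have v: "v \<notin> Domain E \<or> v \<notin> Range E"
  proof (rule ccontr)
    assume "\<not> ?thesis"
    then obtain p q where pq: "(p, v) \<in> E" "(v, q) \<in> E" by blast
    then have "(v, p) \<in> edges E" "(v, q) \<in> edges E" "p \<noteq> q"
      using forcingD(4)[OF fE] by (auto simp: edges_iff)
    then show False
      using no_three_edges[OF fD assms(3), of p q] leaf assms(4) by blast
  qed
  have "x \<in> Domain E \<and> x \<in> Range E"
    using max_forcing_blocked[OF assms(2) xv(1,2) v] .
  then obtain r s where rs: "(x, r) \<in> E" "(s, x) \<in> E" by blast
  then have "(x, r) \<in> edges E" "(x, s) \<in> edges E" "r \<noteq> s"
    using forcingD(4)[OF fE] by (auto simp: edges_iff)
  then obtain y where y: "(x, y) \<in> edges E - edges D"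
    using no_three_edges[OF fD xv(3), of r s] xv(2) by blast
  \<comment> \<open>The exchange takes place at \<open>x\<close>: in \<open>exchange\<close>,
    \<open>x\<close> plays the role of \<open>v\<close>, \<open>y\<close> that of \<open>x\<close>,
    and \<open>v\<close> that of \<open>y\<close>.\<close>
  then show thesis
    using that exchange[OF assms(2) _ xv(1,2) v, of y] by blast
qed

text \<open>Induction on the number of edges of \<open>D\<close> missing in \<open>E\<close>. At a
  leaf \<open>v\<close> of the symmetric difference, \<open>exchange_towards\<close> changes the
  relation that lacks the edge \<open>(v, x)\<close>.\<close>

lemma reconf_max_forcing:
  assumes "max_forcing D" "max_forcing E"
  shows "reconf D E"
  using assms
proof (induction "card (edges D - edges E)" arbitrary: D E rule: less_induct)
  case less
  have fD: "forcing D" and fE: "forcing E" using less.prems by (simp_all add: max_forcingD)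
  show ?case
  proof (cases "edges D = edges E")
    case True
    then show ?thesis using reconf_if_edges_eq less.prems by blast
  next
    case False
    let ?H = "(edges D - edges E) \<union> (edges E - edges D)"
    have "?H \<subseteq> arcs_ends G" "sym ?H" "?H \<noteq> {}"
      using edges_subset[OF fD] edges_subset[OF fE] False by (auto simp: sym_def edges_iff)
    then obtain v x where vx: "(v, x) \<in> ?H" and leaf: "\<And>y. (v, y) \<in> ?H \<Longrightarrow> y = x"
      using ex_leaf by blast
    have fin: "finite (edges D - edges E)" using fD by (simp add: finite_edges)
    show ?thesis
    proof (cases "(v, x) \<in> edges D")
      case True
      then have nE: "(v, x) \<notin> edges E" using vx by blast
      have "(v, z) \<in> edges D" if "(v, z) \<in> edges E" for z
        using that leaf nE by blast
      then obtain F y where F: "max_forcing F" "reconf E F" "(x, y) \<in> edges E - edges D"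
        "edges F = edges E - {(x, y), (y, x)} \<union> {(x, v), (v, x)}"
        using exchange_towards[OF less.prems True nE] by blast
      have "(y, x) \<notin> edges D" using F(3) by (auto simp: edges_iff)
      then have "edges D - edges F \<subset> edges D - edges E"
        using True nE F(3,4) by blast
      then have "reconf D F"
        using less.hyps less.prems(1) F(1) fin psubset_card_mono by metis
      then show ?thesis using F(2) reconf_sym reconf_trans by blast
    next
      \<comment> \<open>Here \<open>D\<close> is changed instead. The measure drops as well: the
        removed edge is missing in \<open>E\<close>, and the added one belongs to
        \<open>E\<close>.\<close>
      case nD: False
      then have E: "(v, x) \<in> edges E" using vx by blast
      then have xv: "(x, v) \<in> edges E" by (auto simp: edges_iff)
      have "(v, z) \<in> edges E" if "(v, z) \<in> edges D" for z
        using that leaf nD by blast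
      then obtain F y where F: "max_forcing F" "reconf D F" "(x, y) \<in> edges D - edges E"
        "edges F = edges D - {(x, y), (y, x)} \<union> {(x, v), (v, x)}"
        using exchange_towards[OF less.prems(2,1) E nD] by blast
      have "edges F - edges E \<subset> edges D - edges E"
        using E xv nD F(3,4) by blast
      then have "reconf F E"
        using less.hyps less.prems(2) F(1) fin psubset_card_mono by metis
      then show ?thesis using F(2) reconf_trans by blast
    qed
  qed
qed

lemma connected_zero_forcing_graph: "connected (with_proj (zero_forcing_graph G))"
proof -
  let ?Z = "zero_forcing_graph G"
  have "(B, C) \<in> rtrancl_on (pverts ?Z) ((parcs ?Z)\<^sup>s)" if BC: "B \<in> pverts ?Z" "C \<in> pverts ?Z" for B C
  proof -
    have "min_zero_forcing_set G B" "min_zero_forcing_set G C"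
      using BC by (simp_all add: zero_forcing_graph_def)
    then obtain D E where "max_forcing D" "sources D = B" "max_forcing E" "sources E = C"
      using min_zero_forcing_set_obtain_forcing by metis
    then have "(B, C) \<in> (parcs ?Z)\<^sup>*"
      using reconf_max_forcing unfolding reconf_def by blast
    then have "(B, C) \<in> ((parcs ?Z)\<^sup>s)\<^sup>*"
      using rtrancl_mono[of "parcs ?Z" "(parcs ?Z)\<^sup>s"] by (auto simp: symcl_def)
    then show ?thesis
      by (rule rtrancl_consistent_rtrancl_on) (use BC in \<open>auto simp: zero_forcing_graph_def symcl_def\<close>)
  qed
  \<comment> \<open>Connectedness includes nonemptiness: a forcing relation with the most edges
    exists, and its sources form a vertex.\<close>
  moreover have "pverts ?Z \<noteq> {}"
    using ex_max_forcing min_zero_forcing_set_sources by (auto simp: zero_forcing_graph_def)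
  ultimately show ?thesis by (simp add: connected_conv)
qed

end

theorem corollary5p3:
  fixes T :: "('a, 'b) pre_digraph"
  assumes "graph T" and "verts T \<noteq> {}" and "acyclic_graph T"
  shows "connected (with_proj (zero_forcing_graph T))"
proof -
  interpret acyclic_sym_graph T
    using assms(1,3) by (simp add: acyclic_sym_graph_def acyclic_sym_graph_axioms_def)
  show ?thesis by (rule connected_zero_forcing_graph)
qed

end
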